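(* Let $F$ be an infinite-dimensional complex Banach space and let $E=F^*$ be its dual, with open unit ball $B_E$. Then the composition mapping $$(f,g)\in(\mathcal{H}(B_E,B_E),\tau_0^* )\times(\mathcal{H}(B_E,B_E),\tau_0^* )\mapsto f\circ g\in(\mathcal{H}(B_E,B_E),\tau_0^* )$$ is not continuous.
   Context: $\mathcal{H}(B_E,E)$ is the space of holomorphic (complex Fréchet differentiable) mappings $B_E\to E$ and $\mathcal{H}(B_E,B_E)$ is the set of those with $f(B_E)\subset B_E$. For an open set $U\subset E=F^*$, the compact-weak*-open topology $\tau_0^*$ on $\mathcal{H}(U,F^* )$ is the one generated by the seminorms $p_{K,L}(f)=\max_{x\in K,\,y\in L}|f(x)(y)|$, with $K\subset U$ compact and $L\subset F$ finite; $\mathcal{H}(B_E,B_E)$ carries the induced topology. *)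

theory Defs
  imports "HOL-Analysis.Analysis"
begin

section \<open>Complex normed and Banach spaces\<close>

text \<open>The distribution only has real normed spaces. As usual, a complex normed space is a real
  normed space with a compatible complex scalar multiplication.\<close>

class complex_normed_vector = real_normed_vector +
  fixes scaleC :: "complex \<Rightarrow> 'a \<Rightarrow> 'a"  (infixr \<open>*\<^sub>C\<close> 75)
  assumes scaleC_add_right: "c *\<^sub>C (x + y) = c *\<^sub>C x + c *\<^sub>C y"
    and scaleC_add_left: "(c + d) *\<^sub>C x = c *\<^sub>C x + d *\<^sub>C x"
    and scaleC_scaleC: "c *\<^sub>C (d *\<^sub>C x) = (c * d) *\<^sub>C x"
    and scaleR_scaleC: "r *\<^sub>R x = complex_of_real r *\<^sub>C x"
    and norm_scaleC: "norm (c *\<^sub>C x) = cmod c * norm x"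

class complex_banach = complex_normed_vector + complete_space

subclass (in complex_banach) banach ..

lemma vector_space_scaleC:
  "vector_space (scaleC :: complex \<Rightarrow> 'a \<Rightarrow> 'a::complex_normed_vector)"
proof
  fix x :: 'a
  have "(1::real) *\<^sub>R x = complex_of_real 1 *\<^sub>C x" by (rule scaleR_scaleC)
  then show "1 *\<^sub>C x = x" by simp
qed (simp_all add: scaleC_add_right scaleC_add_left scaleC_scaleC)

definition cspan :: "'a::complex_normed_vector set \<Rightarrow> 'a set" where
  "cspan = module.span scaleC"

definition finite_dim_complex :: "'a::complex_normed_vector itself \<Rightarrow> bool" where
  "finite_dim_complex _ \<longleftrightarrow> (\<exists>B :: 'a set. finite B \<and> cspan B = UNIV)"


section \<open>The dual space\<close>

text \<open>The norm is the operator norm inherited from the type of bounded real-linear maps, and the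
  topology of the type is the norm topology.\<close>

typedef (overloaded) 'a cdual =
  "{\<phi> :: 'a::complex_normed_vector \<Rightarrow>\<^sub>L complex. \<forall>c x. \<phi> (c *\<^sub>C x) = c * \<phi> x}"
  morphisms blinfun_of_cdual Abs_cdual
  by (rule exI[of _ 0]) simp

setup_lifting type_definition_cdual

lift_definition cdual_apply :: "'a::complex_normed_vector cdual \<Rightarrow> 'a \<Rightarrow> complex"
  is blinfun_apply .

instantiation cdual :: (complex_normed_vector) complex_normed_vector
begin

lift_definition zero_cdual :: "'a cdual" is 0 by simp
lift_definition plus_cdual :: "'a cdual \<Rightarrow> 'a cdual \<Rightarrow> 'a cdual" is "(+)"
  by (simp add: blinfun.add_left algebra_simps)
lift_definition minus_cdual :: "'a cdual \<Rightarrow> 'a cdual \<Rightarrow> 'a cdual" is "(-)"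
  by (simp add: blinfun.diff_left algebra_simps)
lift_definition uminus_cdual :: "'a cdual \<Rightarrow> 'a cdual" is uminus
  by (simp add: blinfun.minus_left)
lift_definition scaleR_cdual :: "real \<Rightarrow> 'a cdual \<Rightarrow> 'a cdual" is scaleR
  by (simp add: blinfun.scaleR_left)
lift_definition scaleC_cdual :: "complex \<Rightarrow> 'a cdual \<Rightarrow> 'a cdual"
  is "\<lambda>c \<phi>. blinfun_mult_right c o\<^sub>L \<phi>"
  by simp
lift_definition norm_cdual :: "'a cdual \<Rightarrow> real" is norm .

definition dist_cdual :: "'a cdual \<Rightarrow> 'a cdual \<Rightarrow> real" where
  "dist_cdual \<phi> \<psi> = norm (\<phi> - \<psi>)"
definition sgn_cdual :: "'a cdual \<Rightarrow> 'a cdual" where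
  "sgn_cdual \<phi> = inverse (norm \<phi>) *\<^sub>R \<phi>"
definition uniformity_cdual :: "('a cdual \<times> 'a cdual) filter" where
  "uniformity_cdual = (INF e\<in>{0<..}. principal {(\<phi>, \<psi>). dist \<phi> \<psi> < e})"
definition open_cdual :: "'a cdual set \<Rightarrow> bool" where
  "open_cdual S \<longleftrightarrow> (\<forall>\<phi>\<in>S. \<forall>\<^sub>F (\<phi>', \<psi>) in uniformity. \<phi>' = \<phi> \<longrightarrow> \<psi> \<in> S)"

lemma norm_mult_blinfun:
  "norm (blinfun_mult_right c o\<^sub>L \<phi>) = cmod c * norm \<phi>"
  for \<phi> :: "'b::real_normed_vector \<Rightarrow>\<^sub>L complex"
proof (rule antisym)
  have *: "norm (blinfun_mult_right d o\<^sub>L \<psi>) \<le> cmod d * norm \<psi>"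
    for d and \<psi> :: "'b \<Rightarrow>\<^sub>L complex"
  proof (rule norm_blinfun_bound)
    fix x
    have "cmod d * cmod (\<psi> x) \<le> cmod d * (norm \<psi> * norm x)"
      by (intro mult_left_mono norm_blinfun) simp
    then show "cmod ((blinfun_mult_right d o\<^sub>L \<psi>) x) \<le> cmod d * norm \<psi> * norm x"
      by (simp add: norm_mult mult.assoc)
  qed simp
  show "norm (blinfun_mult_right c o\<^sub>L \<phi>) \<le> cmod c * norm \<phi>" by (rule *)
  show "cmod c * norm \<phi> \<le> norm (blinfun_mult_right c o\<^sub>L \<phi>)"
  proof (cases "c = 0")
    case False
    have "blinfun_mult_right (inverse c) o\<^sub>L (blinfun_mult_right c o\<^sub>L \<phi>) = \<phi>"
      using False by (intro blinfun_eqI) (simp add: mult.assoc[symmetric])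
    then have "norm \<phi> \<le> inverse (cmod c) * norm (blinfun_mult_right c o\<^sub>L \<phi>)"
      using *[of "inverse c" "blinfun_mult_right c o\<^sub>L \<phi>"] by (simp add: norm_inverse)
    then show ?thesis using False by (simp add: field_simps)
  qed simp
qed

instance
proof
  fix \<phi> \<psi> \<theta> :: "'a cdual" and a b :: real and c d :: complex and S :: "'a cdual set"
  show "\<phi> + \<psi> + \<theta> = \<phi> + (\<psi> + \<theta>)" by transfer simp
  show "\<phi> + \<psi> = \<psi> + \<phi>" by transfer simp
  show "0 + \<phi> = \<phi>" by transfer simp
  show "- \<phi> + \<phi> = 0" by transfer simp
  show "\<phi> - \<psi> = \<phi> + - \<psi>" by transfer simp
  show "a *\<^sub>R (\<phi> + \<psi>) = a *\<^sub>R \<phi> + a *\<^sub>R \<psi>" by transfer (rule scaleR_add_right)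
  show "(a + b) *\<^sub>R \<phi> = a *\<^sub>R \<phi> + b *\<^sub>R \<phi>" by transfer (rule scaleR_add_left)
  show "a *\<^sub>R b *\<^sub>R \<phi> = (a * b) *\<^sub>R \<phi>" by transfer simp
  show "1 *\<^sub>R \<phi> = \<phi>" by transfer simp
  show "dist \<phi> \<psi> = norm (\<phi> - \<psi>)" by (rule dist_cdual_def)
  show "sgn \<phi> = inverse (norm \<phi>) *\<^sub>R \<phi>" by (rule sgn_cdual_def)
  show "uniformity = (INF e\<in>{0<..}. principal {(\<phi>::'a cdual, \<psi>). dist \<phi> \<psi> < e})"
    by (rule uniformity_cdual_def)
  show "open S \<longleftrightarrow> (\<forall>\<phi>\<in>S. \<forall>\<^sub>F (\<phi>', \<psi>) in uniformity. \<phi>' = \<phi> \<longrightarrow> \<psi> \<in> S)"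
    by (rule open_cdual_def)
  show "norm \<phi> = 0 \<longleftrightarrow> \<phi> = 0" by transfer simp
  show "norm (\<phi> + \<psi>) \<le> norm \<phi> + norm \<psi>" by transfer (rule norm_triangle_ineq)
  show "norm (a *\<^sub>R \<phi>) = \<bar>a\<bar> * norm \<phi>" by transfer simp
  show "c *\<^sub>C (\<phi> + \<psi>) = c *\<^sub>C \<phi> + c *\<^sub>C \<psi>"
    by transfer (auto intro!: blinfun_eqI simp: blinfun.add_left algebra_simps)
  show "(c + d) *\<^sub>C \<phi> = c *\<^sub>C \<phi> + d *\<^sub>C \<phi>"
    by transfer (auto intro!: blinfun_eqI simp: blinfun.add_left algebra_simps)
  show "c *\<^sub>C d *\<^sub>C \<phi> = (c * d) *\<^sub>C \<phi>"
    by transfer (auto intro!: blinfun_eqI simp: mult.assoc)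
  show "a *\<^sub>R \<phi> = complex_of_real a *\<^sub>C \<phi>"
    by transfer (auto intro!: blinfun_eqI simp: blinfun.scaleR_left scaleR_conv_of_real)
  show "norm (c *\<^sub>C \<phi>) = cmod c * norm \<phi>"
    by transfer (rule norm_mult_blinfun)
qed

end

lemma cdual_apply_scaleC [simp]: "cdual_apply (c *\<^sub>C \<phi>) x = c * cdual_apply \<phi> x"
  by transfer simp


section \<open>Holomorphic mappings\<close>

definition frechet_holomorphic_on ::
    "('a::complex_normed_vector \<Rightarrow> 'b::complex_normed_vector) \<Rightarrow> 'a set \<Rightarrow> bool" where
  "frechet_holomorphic_on f U \<longleftrightarrow>
     (\<forall>x\<in>U. \<exists>f'. (f has_derivative f') (at x) \<and> (\<forall>c v. f' (c *\<^sub>C v) = c *\<^sub>C f' v))"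

text \<open>A mapping \<open>U \<rightarrow> V\<close> is represented by the total function that is \<^const>\<open>undefined\<close> off \<open>U\<close>,
  so that two elements are equal iff they agree on \<open>U\<close>. The set \<open>U\<close> is meant to be open.\<close>

definition holomorphic_maps ::
    "'a::complex_normed_vector set \<Rightarrow> 'b::complex_normed_vector set \<Rightarrow> ('a \<Rightarrow> 'b) set" where
  "holomorphic_maps U V = {f \<in> U \<rightarrow>\<^sub>E V. frechet_holomorphic_on f U}"

lemma compose_in_holomorphic_maps:
  assumes "open U" "f \<in> holomorphic_maps V W" "g \<in> holomorphic_maps U V"
  shows "compose U f g \<in> holomorphic_maps U W"
proof -
  have g: "g \<in> U \<rightarrow> V" and f: "f \<in> V \<rightarrow> W"
    using assms by (auto simp: holomorphic_maps_def)
  have "frechet_holomorphic_on (compose U f g) U"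
    unfolding frechet_holomorphic_on_def
  proof
    fix x assume x: "x \<in> U"
    obtain g' where g': "(g has_derivative g') (at x)" "\<And>c v. g' (c *\<^sub>C v) = c *\<^sub>C g' v"
      using assms(3) x by (auto simp: holomorphic_maps_def frechet_holomorphic_on_def)
    have "g x \<in> V"
      using g x by (rule funcset_mem)
    then obtain f' where f': "(f has_derivative f') (at (g x))" "\<And>c v. f' (c *\<^sub>C v) = c *\<^sub>C f' v"
      using assms(2) by (auto simp: holomorphic_maps_def frechet_holomorphic_on_def)
    have "(f \<circ> g has_derivative f' \<circ> g') (at x)"
      using g'(1) f'(1) by (rule diff_chain_at)
    then have "(compose U f g has_derivative f' \<circ> g') (at x)"
      using \<open>open U\<close> x by (rule has_derivative_transform_within_open) (simp add: compose_eq)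
    then show "\<exists>h'. (compose U f g has_derivative h') (at x) \<and> (\<forall>c v. h' (c *\<^sub>C v) = c *\<^sub>C h' v)"
      using g'(2) f'(2) by (intro exI[of _ "f' \<circ> g'"]) simp
  qed
  then show ?thesis
    using f g by (auto simp: holomorphic_maps_def compose_def)
qed


section \<open>The compact-weak*-open topology\<close>

definition seminorm_topology ::
    "('a \<Rightarrow> 'b::ab_group_add) set \<Rightarrow> (('a \<Rightarrow> 'b) \<Rightarrow> real) set \<Rightarrow> ('a \<Rightarrow> 'b) topology" where
  "seminorm_topology V P =
     topology_generated_by {{g \<in> V. p (\<lambda>x. g x - f x) < r} | p f r. p \<in> P \<and> f \<in> V \<and> 0 < r}"

text \<open>For \<open>f\<close> continuous on the compact set \<open>K\<close> and \<open>L\<close> finite this supremum is a maximum; inserting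
  \<open>0\<close> only fixes the value if \<open>K\<close> or \<open>L\<close> is empty.\<close>

definition weak_star_seminorm ::
    "'e set \<Rightarrow> 'a::complex_normed_vector set \<Rightarrow> ('e \<Rightarrow> 'a cdual) \<Rightarrow> real" where
  "weak_star_seminorm K L f = Sup (insert 0 ((\<lambda>(x, y). cmod (cdual_apply (f x) y)) ` (K \<times> L)))"

definition compact_weak_star_open ::
    "'a::complex_normed_vector cdual set \<Rightarrow> ('a cdual \<Rightarrow> 'a cdual) topology" where
  "compact_weak_star_open U =
     seminorm_topology (holomorphic_maps U UNIV)
       {weak_star_seminorm K L | K L. K \<subseteq> U \<and> compact K \<and> finite L}"

definition compact_weak_star_open_into ::
    "'a::complex_normed_vector cdual set \<Rightarrow> 'a cdual set \<Rightarrow> ('a cdual \<Rightarrow> 'a cdual) topology" where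
  "compact_weak_star_open_into U V =
     subtopology (compact_weak_star_open U) (holomorphic_maps U V)"

lemma topspace_compact_weak_star_open:
  "topspace (compact_weak_star_open U) = holomorphic_maps U UNIV"
proof
  show "topspace (compact_weak_star_open U) \<subseteq> holomorphic_maps U UNIV"
    unfolding compact_weak_star_open_def seminorm_topology_def by auto
  show "holomorphic_maps U UNIV \<subseteq> topspace (compact_weak_star_open U)"
  proof
    fix f :: "'a cdual \<Rightarrow> 'a cdual"
    assume f: "f \<in> holomorphic_maps U UNIV"
    let ?N = "{g \<in> holomorphic_maps U UNIV. weak_star_seminorm {} {} (\<lambda>x. g x - f x) < 1}"
    have "f \<in> ?N"
      using f by (simp add: weak_star_seminorm_def)
    moreover have "\<exists>p h r. ?N = {g \<in> holomorphic_maps U UNIV. p (\<lambda>x. g x - h x) < r} \<and>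
        p \<in> {weak_star_seminorm K L | K L. K \<subseteq> U \<and> compact K \<and> finite L} \<and>
        h \<in> holomorphic_maps U UNIV \<and> 0 < r"
    proof (intro exI conjI)
      show "?N = ?N" ..
      show "weak_star_seminorm {} {} \<in> {weak_star_seminorm K L | K L. K \<subseteq> U \<and> compact K \<and> finite L}"
        by (intro CollectI exI[of _ "{}"]) simp
    qed (use f in simp_all)
    ultimately show "f \<in> topspace (compact_weak_star_open U)"
      unfolding compact_weak_star_open_def seminorm_topology_def topology_generated_by_topspace
      by (rule_tac X = ?N in UnionI) (rule CollectI, assumption+)
  qed
qed

lemma topspace_compact_weak_star_open_into:
  "topspace (compact_weak_star_open_into U V) = holomorphic_maps U V"
proof -
  have "holomorphic_maps U V \<subseteq> holomorphic_maps U UNIV"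
    unfolding holomorphic_maps_def by (auto simp: PiE_def)
  then show ?thesis
    by (simp add: compact_weak_star_open_into_def topspace_compact_weak_star_open Int_absorb1)
qed

end

theory Submission
  imports Defs
begin

text \<open>Composition is already discontinuous at the pair \<open>(0, 0)\<close>. A neighbourhood of \<open>0\<close> restricts
  \<open>g\<close> only through finitely many vectors \<open>L \<subset> F\<close>, and as \<open>F\<close> is infinite-dimensional the
  annihilator of \<open>L\<close> contains some \<open>v\<close> with \<open>norm v\<close> arbitrarily close to \<open>1\<close>, so that the constant
  map \<open>g = v\<close> is admissible. It restricts \<open>f\<close> only on a compact set, hence only on a ball of radius
  \<open>r < 1\<close>, where \<open>f z = z(u)\<^sup>n w\<close> with \<open>norm u = 1\<close> is as small as we like if \<open>n\<close> is large. Choosing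
  \<open>v\<close> and \<open>u\<close> after \<open>n\<close> with \<open>\<bar>v(u)\<^sup>n\<bar> \<ge> 1 / 2\<close>, the constant \<open>f \<circ> g = v(u)\<^sup>n w\<close> stays away
  from \<open>0\<close>.\<close>

section \<open>The Hahn-Banach theorem\<close>

definition sublinear :: "('a::real_vector \<Rightarrow> real) \<Rightarrow> bool" where
  "sublinear q \<longleftrightarrow> (\<forall>x y. q (x + y) \<le> q x + q y) \<and> (\<forall>c x. 0 \<le> c \<longrightarrow> q (c *\<^sub>R x) = c * q x)"

lemma sublinear_add: "sublinear q \<Longrightarrow> q (x + y) \<le> q x + q y"
  and sublinear_scale: "sublinear q \<Longrightarrow> 0 \<le> c \<Longrightarrow> q (c *\<^sub>R x) = c * q x"
  by (auto simp: sublinear_def)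

lemma sublinear_zero: "sublinear q \<Longrightarrow> q 0 = 0"
  using sublinear_scale[of q 0 0] by simp

lemma sublinear_minus: "sublinear q \<Longrightarrow> - q (- x) \<le> q x"
  using sublinear_add[of q x "- x"] sublinear_zero[of q] by simp

lemma sublinear_norm: "sublinear (norm :: 'a::real_normed_vector \<Rightarrow> real)"
  by (simp add: sublinear_def norm_triangle_ineq)

text \<open>Homogeneity up to an inequality suffices for \<open>0 < c\<close>: using it for
  \<open>inverse c\<close> at \<open>c *\<^sub>R x\<close> reverses it.\<close>

lemma sublinearI:
  assumes "\<And>x y. q (x + y) \<le> q x + q y" "\<And>c x. 0 < c \<Longrightarrow> q (c *\<^sub>R x) \<le> c * q x" "q 0 = 0"
  shows "sublinear q"
proof -
  have "q (c *\<^sub>R x) = c * q x" if "0 \<le> c" for c x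
  proof (cases "c = 0")
    case False
    then have c: "0 < c" using that by simp
    have "c * q x \<le> q (c *\<^sub>R x)"
      using assms(2)[of "inverse c" "c *\<^sub>R x"] c by (simp add: field_simps)
    with assms(2)[OF c] show ?thesis by (simp add: order_antisym)
  qed (simp add: assms(3))
  with assms(1) show ?thesis by (simp add: sublinear_def)
qed

text \<open>Minimal sublinear functionals are linear: \<open>sublinear_along q a\<close> lies below \<open>q\<close>, so by minimality
  it equals \<open>q\<close>, and its value at \<open>- a\<close> then gives \<open>q (- a) = - q a\<close>. Working with functionals on the
  whole space avoids extending partially defined linear maps.\<close>

definition sublinear_along :: "('a::real_vector \<Rightarrow> real) \<Rightarrow> 'a \<Rightarrow> 'a \<Rightarrow> real" where
  "sublinear_along q a x = (INF t\<in>{0..}. q (x + t *\<^sub>R a) - t * q a)"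

text \<open>The last two bounds are the values of the infimum's argument at \<open>t = 0\<close> and
  \<open>t = 1\<close>; sublinearity comes from adding or rescaling the parameters
  \<open>t\<close>.\<close>

lemma
  assumes q: "sublinear q"
  shows sublinear_along: "sublinear (sublinear_along q a)"
    and sublinear_along_le: "sublinear_along q a x \<le> q x"
    and sublinear_along_minus_le: "sublinear_along q a (- a) \<le> - q a"
proof -
  let ?S = "\<lambda>x. (\<lambda>t. q (x + t *\<^sub>R a) - t * q a) ` {0..}"
  \<comment> \<open>Subadditivity at \<open>t *\<^sub>R a = (x + t *\<^sub>R a) + (- x)\<close>
    gives a bound independent of \<open>t\<close>, without which the real infimum would carry no
    information.\<close>
  have lb: "- q (- x) \<le> q (x + t *\<^sub>R a) - t * q a" if "0 \<le> t" for x t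
    using sublinear_add[OF q, of "x + t *\<^sub>R a" "- x"] sublinear_scale[OF q that, of a] by simp
  then have bdd: "bdd_below (?S x)" for x
    by (intro bdd_belowI2[where m = "- q (- x)"]) simp
  have le: "sublinear_along q a x \<le> q (x + t *\<^sub>R a) - t * q a" if "0 \<le> t" for x t
    unfolding sublinear_along_def using that by (intro cINF_lower[OF bdd]) simp
  have ge: "m \<le> sublinear_along q a x" if "\<And>t. 0 \<le> t \<Longrightarrow> m \<le> q (x + t *\<^sub>R a) - t * q a" for m x
    unfolding sublinear_along_def using that by (intro cINF_greatest) auto
  show le0: "sublinear_along q a x \<le> q x" for x
    using le[of 0 x] by simp
  show "sublinear_along q a (- a) \<le> - q a"
    using le[of 1 "- a"] sublinear_zero[OF q] by simp
  show "sublinear (sublinear_along q a)"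
  proof (rule sublinearI)
    fix x y
    \<comment> \<open>Parameter \<open>s\<close> for \<open>x\<close> and \<open>t\<close> for
      \<open>y\<close> combine to \<open>s + t\<close> for \<open>x + y\<close>. The infima over
      \<open>s\<close> and then over \<open>t\<close> are taken one at a time.\<close>
    have "sublinear_along q a (x + y) - (q (y + t *\<^sub>R a) - t * q a) \<le> q (x + s *\<^sub>R a) - s * q a"
      if "0 \<le> s" "0 \<le> t" for s t
      using le[of "s + t" "x + y"] that sublinear_add[OF q, of "x + s *\<^sub>R a" "y + t *\<^sub>R a"]
      by (simp add: algebra_simps)
    then have "sublinear_along q a (x + y) - (q (y + t *\<^sub>R a) - t * q a) \<le> sublinear_along q a x"
      if "0 \<le> t" for t
      using that by (intro ge)
    then have "sublinear_along q a (x + y) - sublinear_along q a x \<le> sublinear_along q a y"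
      by (intro ge) (simp add: algebra_simps)
    then show "sublinear_along q a (x + y) \<le> sublinear_along q a x + sublinear_along q a y"
      by simp
  next
    fix c :: real and x assume c: "0 < c"
    have "sublinear_along q a (c *\<^sub>R x) / c \<le> q (x + t *\<^sub>R a) - t * q a" if "0 \<le> t" for t
      using le[of "c * t" "c *\<^sub>R x"] that c sublinear_scale[OF q, of c "x + t *\<^sub>R a"]
      by (simp add: field_simps scaleR_add_right)
    then have "sublinear_along q a (c *\<^sub>R x) / c \<le> sublinear_along q a x"
      by (rule ge)
    then show "sublinear_along q a (c *\<^sub>R x) \<le> c * sublinear_along q a x"
      using c by (simp add: field_simps)
  next
    have "0 \<le> sublinear_along q a 0"
      using lb[of _ 0] sublinear_zero[OF q] by (intro ge) simp
    with le0[of 0] show "sublinear_along q a 0 = 0"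
      using sublinear_zero[OF q] by simp
  qed
qed

text \<open>The pointwise infimum works: it is finite because
  \<open>- p (- x) \<le> - q (- x) \<le> q x\<close>. The chain condition serves subadditivity,
  where \<open>q x + r y\<close> is compared with the smaller of \<open>q\<close> and
  \<open>r\<close>.\<close>

lemma sublinear_INF_chain:
  assumes "C \<noteq> {}" and C: "\<And>q. q \<in> C \<Longrightarrow> sublinear q \<and> q \<le> p"
    and chain: "\<And>q r. q \<in> C \<Longrightarrow> r \<in> C \<Longrightarrow> q \<le> r \<or> r \<le> q"
  shows "\<exists>m. sublinear m \<and> m \<le> p \<and> (\<forall>q\<in>C. m \<le> q)"
proof (intro exI conjI ballI)
  let ?m = "\<lambda>x. INF q\<in>C. q x"
  have "- p (- x) \<le> q x" if "q \<in> C" for q x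
    using C[OF that] sublinear_minus[of q x] by (force simp: le_fun_def intro: order_trans[rotated])
  then have bdd: "bdd_below ((\<lambda>q. q x) ` C)" for x
    by (intro bdd_belowI2)
  have le: "?m x \<le> q x" if "q \<in> C" for q x
    using that by (rule cINF_lower[OF bdd])
  show m_le: "?m \<le> q" if "q \<in> C" for q
    using le[OF that] by (simp add: le_fun_def)
  have ge: "c \<le> ?m x" if "\<And>q. q \<in> C \<Longrightarrow> c \<le> q x" for c x
    using \<open>C \<noteq> {}\<close> that by (rule cINF_greatest)
  show "?m \<le> p"
    using \<open>C \<noteq> {}\<close> m_le C order_trans by blast
  show "sublinear ?m"
  proof (rule sublinearI)
    fix x y
    have "?m (x + y) - r y \<le> q x" if "q \<in> C" "r \<in> C" for q r
    proof -
      obtain s where s: "s \<in> C" "s \<le> q" "s \<le> r"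
        by (metis chain order_refl \<open>q \<in> C\<close> \<open>r \<in> C\<close>)
      then have "?m (x + y) \<le> s x + s y"
        using le[of s "x + y"] C[OF s(1)] sublinear_add[of s x y] by linarith
      moreover have "s x \<le> q x" "s y \<le> r y"
        using s by (auto simp: le_fun_def)
      ultimately show ?thesis by linarith
    qed
    then have "?m (x + y) - r y \<le> ?m x" if "r \<in> C" for r
      using that by (intro ge)
    then have "?m (x + y) - ?m x \<le> ?m y"
      by (intro ge) (simp add: algebra_simps)
    then show "?m (x + y) \<le> ?m x + ?m y" by simp
  next
    fix c :: real and x assume c: "0 < c"
    have "?m (c *\<^sub>R x) / c \<le> q x" if "q \<in> C" for q
      using le[OF that, of "c *\<^sub>R x"] C[OF that] c sublinear_scale[of q c x]
      by (simp add: field_simps)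
    then have "?m (c *\<^sub>R x) / c \<le> ?m x"
      by (rule ge)
    then show "?m (c *\<^sub>R x) \<le> c * ?m x"
      using c by (simp add: field_simps)
  next
    show "?m 0 = 0"
      using \<open>C \<noteq> {}\<close> C by (simp add: sublinear_zero cong: INF_cong_simp)
  qed
qed

lemma minimal_sublinear_exists:
  assumes "sublinear p"
  obtains m where "sublinear m" "m \<le> p" "\<And>q. sublinear q \<Longrightarrow> q \<le> m \<Longrightarrow> q = m"
proof -
  let ?A = "{q. sublinear q \<and> q \<le> p}"
  \<comment> \<open>The order is reversed, so that Zorn's maximal elements are minimal functionals
    and chains need lower bounds.\<close>
  let ?r = "relation_of (\<lambda>q r. r \<le> q) ?A"
  have "\<exists>m\<in>?A. \<forall>q\<in>?A. q \<le> m \<longrightarrow> q = m"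
  proof (rule predicate_Zorn)
    show "partial_order_on ?A ?r"
      by (rule partial_order_on_relation_ofI) auto
  next
    fix C assume C: "C \<in> Chains ?r"
    show "\<exists>u\<in>?A. \<forall>q\<in>C. u \<le> q"
    proof (cases "C = {}")
      case True
      then show ?thesis using assms by auto
    next
      case False
      from C have "\<exists>m. sublinear m \<and> m \<le> p \<and> (\<forall>q\<in>C. m \<le> q)"
        by (intro sublinear_INF_chain[OF False]) (auto simp: Chains_def relation_of_def)
      then show ?thesis by blast
    qed
  qed
  then obtain m where m: "sublinear m" "m \<le> p"
    and min: "\<And>q. sublinear q \<Longrightarrow> q \<le> p \<Longrightarrow> q \<le> m \<Longrightarrow> q = m"
    by blast
  show ?thesis
    using min order_trans[OF _ m(2)] by (intro that[OF m]) auto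
qed

lemma Hahn_Banach_sublinear:
  assumes p: "sublinear p"
  obtains h where "linear h" "\<And>x. h x \<le> p x" "h a = p a"
proof -
  \<comment> \<open>Minimizing below \<open>sublinear_along p a\<close> instead of \<open>p\<close>
    pins the value at \<open>a\<close>: it forces \<open>m (- a) \<le> - p a\<close>, which becomes
    \<open>p a \<le> m a\<close> once \<open>m\<close> is known to be odd.\<close>
  obtain m where m: "sublinear m" "m \<le> sublinear_along p a"
    and min: "\<And>q. sublinear q \<Longrightarrow> q \<le> m \<Longrightarrow> q = m"
    using minimal_sublinear_exists[OF sublinear_along[OF p]] by blast
  have "sublinear_along m b = m" for b
    using sublinear_along[OF m(1)] sublinear_along_le[OF m(1)] by (intro min) (auto simp: le_fun_def)
  then have neg: "m (- b) = - m b" for b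
    using sublinear_along_minus_le[OF m(1), of b] sublinear_minus[OF m(1), of b] by simp
  \<comment> \<open>The reverse inequality is subadditivity at \<open>x + y\<close> and
    \<open>- y\<close>, combined with oddness.\<close>
  have add: "m (x + y) = m x + m y" for x y
    using sublinear_add[OF m(1), of x y] sublinear_add[OF m(1), of "x + y" "- y"] neg[of y] by simp
  have "m (c *\<^sub>R x) = c * m x" for c x
    using sublinear_scale[OF m(1), of c x] sublinear_scale[OF m(1), of "- c" x] neg[of "c *\<^sub>R x"]
    by (cases "0 \<le> c") auto
  with add have "linear m"
    by (intro linearI) auto
  moreover have le: "m x \<le> p x" for x
    using m(2) sublinear_along_le[OF p, of a x] by (auto simp: le_fun_def intro: order_trans)
  moreover have "m a = p a"
  proof (rule antisym)
    have "m (- a) \<le> - p a"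
      using m(2) sublinear_along_minus_le[OF p, of a] by (auto simp: le_fun_def intro: order_trans)
    then show "p a \<le> m a" using neg[of a] by simp
  qed (rule le)
  ultimately show ?thesis using that by blast
qed

section \<open>Continuous linear functionals\<close>

lemma cdual_of_bounded_linear:
  fixes h :: "'a::complex_normed_vector \<Rightarrow> complex"
  assumes "bounded_linear h" "\<And>c x. h (c *\<^sub>C x) = c * h x"
  obtains \<phi> where "cdual_apply \<phi> = h"
proof
  show "cdual_apply (Abs_cdual (Blinfun h)) = h"
    using assms by (simp add: cdual_apply.rep_eq Abs_cdual_inverse bounded_linear_Blinfun_apply)
qed

lemma norm_cdual_apply: "cmod (cdual_apply \<phi> x) \<le> norm \<phi> * norm x"
  by transfer (rule norm_blinfun)

lemma bounded_linear_cdual_apply: "bounded_linear (\<lambda>\<phi>. cdual_apply \<phi> x)"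
proof (rule bounded_linear_intro)
  show "cmod (cdual_apply \<phi> x) \<le> norm \<phi> * norm x" for \<phi> by (rule norm_cdual_apply)
qed (transfer, simp add: blinfun.add_left blinfun.scaleR_left)+

lemmas cdual_apply_zero_left [simp] = linear_0[OF bounded_linear.linear[OF bounded_linear_cdual_apply]]
  and cdual_apply_diff_left = linear_diff[OF bounded_linear.linear[OF bounded_linear_cdual_apply]]

lemma cdual_apply_add_right: "cdual_apply \<phi> (x + y) = cdual_apply \<phi> x + cdual_apply \<phi> y"
  and cdual_apply_diff_right: "cdual_apply \<phi> (x - y) = cdual_apply \<phi> x - cdual_apply \<phi> y"
  and cdual_apply_zero_right [simp]: "cdual_apply \<phi> 0 = 0"
  and cdual_apply_scaleR_right: "cdual_apply \<phi> (r *\<^sub>R x) = r *\<^sub>R cdual_apply \<phi> x"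
  and cdual_apply_scaleC_right: "cdual_apply \<phi> (c *\<^sub>C x) = c * cdual_apply \<phi> x"
  by (transfer, simp add: blinfun.add_right blinfun.diff_right blinfun.scaleR_right)+

text \<open>The operator norm is the least bound, so \<open>s * norm \<phi>\<close> cannot be one.
  Strictness excludes \<open>x = 0\<close>, and \<open>x\<close> can be normalized.\<close>

lemma cdual_norm_approx:
  fixes \<phi> :: "'a::complex_normed_vector cdual"
  assumes "\<phi> \<noteq> 0" "0 \<le> s" "s < 1"
  obtains u where "norm u = 1" "s * norm \<phi> < cmod (cdual_apply \<phi> u)"
proof -
  have "\<exists>x. s * norm \<phi> * norm x < cmod (cdual_apply \<phi> x)"
  proof (rule ccontr)
    assume "\<nexists>x. s * norm \<phi> * norm x < cmod (cdual_apply \<phi> x)"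
    then have "norm \<phi> \<le> s * norm \<phi>"
      using assms(2) by transfer (auto intro!: norm_blinfun_bound simp: not_less)
    then show False using assms by (simp add: mult_le_cancel_right1)
  qed
  then obtain x where x: "s * norm \<phi> * norm x < cmod (cdual_apply \<phi> x)" by blast
  then have "x \<noteq> 0" by auto
  show ?thesis
  proof (rule that)
    show "norm ((1 / norm x) *\<^sub>R x) = 1" using \<open>x \<noteq> 0\<close> by simp
    show "s * norm \<phi> < cmod (cdual_apply \<phi> ((1 / norm x) *\<^sub>R x))"
      using x \<open>x \<noteq> 0\<close> by (simp add: cdual_apply_scaleR_right field_simps)
  qed
qed

lemma cdual_separates_zero:
  fixes a :: "'a::complex_normed_vector"
  assumes "a \<noteq> 0"
  obtains \<phi> where "cdual_apply \<phi> a \<noteq> 0"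
proof -
  interpret vector_space "scaleC :: complex \<Rightarrow> 'a \<Rightarrow> 'a" by (rule vector_space_scaleC)
  obtain h :: "'a \<Rightarrow> real" where h: "linear h" "\<And>x. h x \<le> norm x" "h a = norm a"
    using Hahn_Banach_sublinear[OF sublinear_norm] by blast
  have h_abs: "\<bar>h x\<bar> \<le> norm x" for x
    using h(2)[of x] h(2)[of "- x"] linear_neg[OF h(1), of x] by simp
  \<comment> \<open>The standard complexification: \<open>?g\<close> is the complex-linear
    functional with real part \<open>h\<close>, hence nonzero at \<open>a\<close>.\<close>
  let ?g = "\<lambda>x. Complex (h x) (- h (\<i> *\<^sub>C x))"
  have hadd: "h (x + y) = h x + h y" and hscale: "h (r *\<^sub>R x) = r * h x" for x y r
    using h(1) by (simp_all add: linear_add linear_scale)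
  have hC: "h (c *\<^sub>C x) = Re c * h x + Im c * h (\<i> *\<^sub>C x)" for c x
  proof -
    have "c *\<^sub>C x = Re c *\<^sub>R x + Im c *\<^sub>R (\<i> *\<^sub>C x)"
      by (simp add: scaleR_scaleC scaleC_scaleC flip: scaleC_add_left)
        (simp add: complex_eq mult.commute)
    then show ?thesis by (simp add: hadd hscale)
  qed
  have "bounded_linear ?g"
  proof (rule bounded_linear_intro)
    fix x y :: 'a and r :: real
    show "?g (x + y) = ?g x + ?g y"
      by (simp add: complex_eq_iff hadd scaleC_add_right)
    have "\<i> *\<^sub>C (r *\<^sub>R x) = r *\<^sub>R (\<i> *\<^sub>C x)"
      by (simp add: scaleR_scaleC scaleC_scaleC mult.commute)
    then show "?g (r *\<^sub>R x) = r *\<^sub>R ?g x"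
      by (simp add: complex_eq_iff hscale)
    have "cmod (?g x) \<le> \<bar>h x\<bar> + \<bar>h (\<i> *\<^sub>C x)\<bar>"
      using cmod_le[of "?g x"] by simp
    also have "\<dots> \<le> norm x * 2"
      using h_abs[of x] h_abs[of "\<i> *\<^sub>C x"] by (simp add: norm_scaleC)
    finally show "cmod (?g x) \<le> norm x * 2" .
  qed
  moreover have "?g (c *\<^sub>C x) = c * ?g x" for c x
    using hC[of c x] hC[of "\<i> * c" x] by (simp add: complex_eq_iff scaleC_scaleC algebra_simps)
  ultimately obtain \<phi> where "cdual_apply \<phi> = ?g"
    by (rule cdual_of_bounded_linear)
  then have "cdual_apply \<phi> a \<noteq> 0"
    using assms h(3) by (simp add: complex_eq_iff)
  then show ?thesis by (rule that)
qed

text \<open>Induction on \<open>L\<close> needs Hahn-Banach only for the norm, not the closedness of finite-dimensional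
  subspaces.\<close>

lemma cdual_separates_finite_span:
  fixes x :: "'a::complex_normed_vector"
  assumes "finite L" "x \<notin> cspan L"
  obtains \<phi> where "\<And>y. y \<in> L \<Longrightarrow> cdual_apply \<phi> y = 0" "cdual_apply \<phi> x \<noteq> 0"
proof -
  interpret vector_space "scaleC :: complex \<Rightarrow> 'a \<Rightarrow> 'a" by (rule vector_space_scaleC)
  from assms have "\<exists>\<phi>. (\<forall>y\<in>L. cdual_apply \<phi> y = 0) \<and> cdual_apply \<phi> x \<noteq> 0"
    unfolding cspan_def
  proof (induction L arbitrary: x)
    case empty
    then show ?case using cdual_separates_zero[of x] by auto
  next
    case (insert b L)
    show ?case
    proof (cases "b \<in> span L")
      case True
      then have "x \<notin> span L" using insert.prems by (simp add: span_redundant)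
      then obtain \<phi> where \<phi>: "\<forall>y\<in>L. cdual_apply \<phi> y = 0" "cdual_apply \<phi> x \<noteq> 0"
        using insert.IH by blast
      have "subspace {y. cdual_apply \<phi> y = 0}"
        by (auto simp: subspace_def cdual_apply_add_right cdual_apply_scaleC_right)
      then have "span L \<subseteq> {y. cdual_apply \<phi> y = 0}"
        using \<phi>(1) by (intro span_minimal) auto
      with \<phi> True show ?thesis by blast
    next
      case False
      \<comment> \<open>\<theta> vanishes on \<open>L\<close> but not at \<open>b\<close>, so
        multiples of it can correct the value at \<open>b\<close> without disturbing
        \<open>L\<close>.\<close>
      then obtain \<theta> where \<theta>: "\<forall>y\<in>L. cdual_apply \<theta> y = 0" "cdual_apply \<theta> b \<noteq> 0"
        using insert.IH by blast
      \<comment> \<open>With this \<open>c\<close>, \<theta> vanishes at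
        \<open>x - c *\<^sub>C b\<close>. Hence correcting \<psi> below by a multiple of \<theta>
        does not change its value there, and killing the value at \<open>b\<close> makes this also
        the value at \<open>x\<close>.\<close>
      define c where "c = cdual_apply \<theta> x / cdual_apply \<theta> b"
      have "x - c *\<^sub>C b \<notin> span L"
        using insert.prems by (auto simp: span_insert)
      then obtain \<psi> where \<psi>: "\<forall>y\<in>L. cdual_apply \<psi> y = 0" "cdual_apply \<psi> (x - c *\<^sub>C b) \<noteq> 0"
        using insert.IH by blast
      let ?\<phi> = "\<psi> - (cdual_apply \<psi> b / cdual_apply \<theta> b) *\<^sub>C \<theta>"
      have "\<forall>y\<in>insert b L. cdual_apply ?\<phi> y = 0"
        using \<theta> \<psi>(1) by (simp add: cdual_apply_diff_left)
      moreover have "cdual_apply ?\<phi> x = cdual_apply \<psi> (x - c *\<^sub>C b)"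
        by (simp add: cdual_apply_diff_left cdual_apply_diff_right cdual_apply_scaleC_right c_def)
      ultimately show ?thesis using \<psi>(2) by (intro exI[of _ ?\<phi>]) simp
    qed
  qed
  with that show ?thesis by blast
qed

text \<open>Infinite dimension enters here: the span of \<open>L\<close> misses some
  \<open>x\<close>, and a functional separating \<open>x\<close> from \<open>L\<close> is
  nonzero.\<close>

lemma annihilator_of_finite_nontrivial:
  fixes L :: "'a::complex_normed_vector set"
  assumes "\<not> finite_dim_complex TYPE('a)" "finite L"
  obtains \<phi> :: "'a cdual" where "\<phi> \<noteq> 0" "\<forall>y\<in>L. cdual_apply \<phi> y = 0"
proof -
  obtain x where "x \<notin> cspan L"
    using assms unfolding finite_dim_complex_def by blast
  with cdual_separates_finite_span[OF assms(2)] that show ?thesis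
    by (metis cdual_apply_zero_left)
qed

section \<open>Neighbourhoods in the compact-weak*-open topology\<close>

text \<open>The norm attains its maximum on \<open>K\<close>, and that maximum is below 1.\<close>

lemma compact_subset_ball_smaller:
  fixes K :: "'a::real_normed_vector set"
  assumes "compact K" "K \<subseteq> ball 0 1"
  obtains r where "0 \<le> r" "r < 1" "K \<subseteq> cball 0 r"
proof (cases "K = {}")
  case False
  then obtain x where "x \<in> K" "\<forall>y\<in>K. norm y \<le> norm x"
    using continuous_attains_sup[OF assms(1), of norm] continuous_on_norm_id by blast
  with assms(2) show ?thesis
    by (intro that[of "norm x"]) auto
qed (use that[of 0] in auto)

section \<open>Bounds for the defining seminorms\<close>

lemma holomorphic_maps_continuous_on:
  assumes "f \<in> holomorphic_maps U V"
  shows "continuous_on U f"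
  using assms unfolding holomorphic_maps_def frechet_holomorphic_on_def
  by (auto intro!: continuous_at_imp_continuous_on dest: has_derivative_continuous)

text \<open>The real \<open>Sup\<close> is meaningful only for bounded sets. Here
  \<open>norm (f x)\<close> is bounded on the compact \<open>K\<close>, and the sum of the norms
  over \<open>L\<close> bounds each of them.\<close>

lemma weak_star_seminorm_bdd:
  assumes "continuous_on K f" "compact K" "finite L"
  shows "bdd_above (insert 0 ((\<lambda>(x, y). cmod (cdual_apply (f x) y)) ` (K \<times> L)))"
proof -
  obtain M where M: "\<And>x. x \<in> K \<Longrightarrow> norm (f x) \<le> M"
    using compact_imp_bounded[OF compact_continuous_image[OF assms(1,2)]]
    unfolding bounded_iff by auto
  have "cmod (cdual_apply (f x) y) \<le> M * (\<Sum>y\<in>L. norm y)" if "x \<in> K" "y \<in> L" for x y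
  proof -
    have "norm y \<le> (\<Sum>y\<in>L. norm y)"
      using that(2) assms(3) by (intro member_le_sum) auto
    moreover have "0 \<le> M"
      using M[OF that(1)] norm_ge_zero order_trans by blast
    ultimately have "norm (f x) * norm y \<le> M * (\<Sum>y\<in>L. norm y)"
      using M[OF that(1)] by (intro mult_mono) auto
    with norm_cdual_apply show ?thesis by (rule order_trans)
  qed
  then show ?thesis
    by (auto intro!: bdd_aboveI2)
qed

lemma weak_star_seminorm_upper:
  assumes "continuous_on K f" "compact K" "finite L" "x \<in> K" "y \<in> L"
  shows "cmod (cdual_apply (f x) y) \<le> weak_star_seminorm K L f"
  unfolding weak_star_seminorm_def using assms
  by (intro cSup_upper weak_star_seminorm_bdd) auto

lemma weak_star_seminorm_least:
  assumes "0 \<le> c" "\<And>x y. x \<in> K \<Longrightarrow> y \<in> L \<Longrightarrow> cmod (cdual_apply (f x) y) \<le> c"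
  shows "weak_star_seminorm K L f \<le> c"
  unfolding weak_star_seminorm_def using assms by (intro cSup_least) auto

lemma weak_star_seminorm_nonneg:
  assumes "continuous_on K f" "compact K" "finite L"
  shows "0 \<le> weak_star_seminorm K L f"
  unfolding weak_star_seminorm_def using assms
  by (intro cSup_upper weak_star_seminorm_bdd) auto

text \<open>Compact sets are traded for balls of radius \<open>r < 1\<close> containing them, since
  closeness to \<open>f\<close> on the ball implies closeness on the compact set. The induction
  follows the generation of the topology; an intersection takes the larger radius, the union of the
  finite sets and the smaller bound.\<close>

lemma openin_compact_weak_star_open_nbhd:
  fixes W :: "('a::complex_normed_vector cdual \<Rightarrow> 'a cdual) set"
  assumes "openin (compact_weak_star_open (ball 0 1)) W" "f \<in> W"
  obtains r L \<epsilon> where "0 \<le> r" "r < 1" "finite L" "0 < \<epsilon>"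
    "\<forall>g\<in>holomorphic_maps (ball 0 1) UNIV.
      (\<forall>x y. norm x \<le> r \<longrightarrow> y \<in> L \<longrightarrow> cmod (cdual_apply (g x - f x) y) \<le> \<epsilon>) \<longrightarrow> g \<in> W"
proof -
  let ?H = "holomorphic_maps (ball 0 1) UNIV :: ('a cdual \<Rightarrow> 'a cdual) set"
  let ?near = "\<lambda>r L \<epsilon> g. \<forall>x y. norm x \<le> r \<longrightarrow> y \<in> L \<longrightarrow> cmod (cdual_apply (g x - f x) y) \<le> \<epsilon>"
  let ?P = "\<lambda>W r L \<epsilon>. 0 \<le> r \<and> r < 1 \<and> finite L \<and> 0 < (\<epsilon>::real) \<and> (\<forall>g\<in>?H. ?near r L \<epsilon> g \<longrightarrow> g \<in> W)"
  have f: "f \<in> ?H"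
    using assms openin_subset[OF assms(1)] unfolding topspace_compact_weak_star_open by blast
  have "\<exists>r L \<epsilon>. ?P W r L \<epsilon>"
    using assms
    unfolding compact_weak_star_open_def seminorm_topology_def openin_topology_generated_by_iff
  proof (induction rule: generate_topology_on.induct)
    case Empty
    then show ?case by simp
  next
    case (Int a b)
    then obtain r L \<epsilon> r' L' \<epsilon>' where P: "?P a r L \<epsilon>" "?P b r' L' \<epsilon>'"
      by blast
    have "?near r L \<epsilon> g \<and> ?near r' L' \<epsilon>' g"
      if "?near (max r r') (L \<union> L') (min \<epsilon> \<epsilon>') g" for g
      using that by simp
    with P have "\<forall>g\<in>?H. ?near (max r r') (L \<union> L') (min \<epsilon> \<epsilon>') g \<longrightarrow> g \<in> a \<inter> b"
      by blast
    with P have "?P (a \<inter> b) (max r r') (L \<union> L') (min \<epsilon> \<epsilon>')"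
      by (simp only: max_less_iff_conj min_less_iff_conj le_max_iff_disj finite_Un simp_thms)
    then show ?case by (intro exI)
  next
    case (UN \<U>)
    then obtain a where "a \<in> \<U>" "f \<in> a" by blast
    from UN.IH[OF this] obtain r L \<epsilon> where P: "?P a r L \<epsilon>" by (elim exE)
    with \<open>a \<in> \<U>\<close> have "\<forall>g\<in>?H. ?near r L \<epsilon> g \<longrightarrow> g \<in> \<Union>\<U>"
      by (meson UnionI)
    with P have "?P (\<Union>\<U>) r L \<epsilon>"
      by (simp only: simp_thms)
    then show ?case by (intro exI)
  next
    case (Basis s)
    then obtain K L h \<delta> where s: "s = {g \<in> ?H. weak_star_seminorm K L (\<lambda>x. g x - h x) < \<delta>}"
      and K: "K \<subseteq> ball 0 1" "compact K" "finite L" and h: "h \<in> ?H"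
      by blast
    obtain r where r: "0 \<le> r" "r < 1" "K \<subseteq> cball 0 r"
      using compact_subset_ball_smaller[OF K(2,1)] .
    let ?p = "weak_star_seminorm K L (\<lambda>x. f x - h x)"
    \<comment> \<open>The subbasic set is centred at \<open>h\<close>, not at \<open>f\<close>. Half
      of the slack left by \<open>f\<close> keeps the final inequality strict, as the supremum is
      only estimated by \<open>\<le>\<close>.\<close>
    define \<epsilon> where "\<epsilon> = (\<delta> - ?p) / 2"
    have "?p < \<delta>" using Basis s by blast
    then have \<epsilon>: "0 < \<epsilon>" "?p + \<epsilon> < \<delta>" by (auto simp: \<epsilon>_def field_simps)
    have "continuous_on (ball 0 1) (\<lambda>x. f x - h x)"
      using f h by (intro continuous_on_diff holomorphic_maps_continuous_on)
    then have cont: "continuous_on K (\<lambda>x. f x - h x)"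
      using K(1) by (rule continuous_on_subset)
    have "g \<in> s" if g: "g \<in> ?H" "?near r L \<epsilon> g" for g
    proof -
      have "weak_star_seminorm K L (\<lambda>x. g x - h x) \<le> ?p + \<epsilon>"
      proof (rule weak_star_seminorm_least)
        show "0 \<le> ?p + \<epsilon>"
          using weak_star_seminorm_nonneg[OF cont K(2,3)] \<epsilon>(1) by simp
        fix x y assume "x \<in> K" "y \<in> L"
        have "cdual_apply (g x - h x) y = cdual_apply (f x - h x) y + cdual_apply (g x - f x) y"
          by (simp add: cdual_apply_diff_left)
        moreover have "cmod (cdual_apply (f x - h x) y) \<le> ?p"
          using cont K(2,3) \<open>x \<in> K\<close> \<open>y \<in> L\<close> by (rule weak_star_seminorm_upper)
        moreover have "cmod (cdual_apply (g x - f x) y) \<le> \<epsilon>"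
          using g(2) r(3) \<open>x \<in> K\<close> \<open>y \<in> L\<close> by auto
        ultimately show "cmod (cdual_apply (g x - h x) y) \<le> ?p + \<epsilon>"
          using norm_triangle_ineq[of "cdual_apply (f x - h x) y" "cdual_apply (g x - f x) y"]
          by simp
      qed
      with g(1) \<epsilon>(2) s show ?thesis by simp
    qed
    with r \<epsilon>(1) K(3) show ?case by blast
  qed
  then show ?thesis using that by blast
qed

lemma holomorphic_maps_into_subset: "holomorphic_maps U V \<subseteq> holomorphic_maps U UNIV"
  unfolding holomorphic_maps_def by (auto simp: PiE_def)

lemma openin_compact_weak_star_open_into_nbhd:
  fixes V :: "'a::complex_normed_vector cdual set"
  assumes "openin (compact_weak_star_open_into (ball 0 1) V) W" "f \<in> W"
  obtains r L \<epsilon> where "0 \<le> r" "r < 1" "finite L" "0 < \<epsilon>"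
    "\<forall>g\<in>holomorphic_maps (ball 0 1) V.
      (\<forall>x y. norm x \<le> r \<longrightarrow> y \<in> L \<longrightarrow> cmod (cdual_apply (g x - f x) y) \<le> \<epsilon>) \<longrightarrow> g \<in> W"
proof -
  obtain W' where W': "openin (compact_weak_star_open (ball 0 1)) W'"
    "W = W' \<inter> holomorphic_maps (ball 0 1) V"
    using assms(1) unfolding compact_weak_star_open_into_def openin_subtopology by blast
  have "f \<in> W'" using assms(2) W'(2) by blast
  obtain r L \<epsilon> where
    "0 \<le> r" "r < 1" "finite L" "0 < \<epsilon>"
    "\<forall>g\<in>holomorphic_maps (ball 0 1) UNIV.
      (\<forall>x y. norm x \<le> r \<longrightarrow> y \<in> L \<longrightarrow> cmod (cdual_apply (g x - f x) y) \<le> \<epsilon>) \<longrightarrow> g \<in> W'"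
    by (rule openin_compact_weak_star_open_nbhd[OF W'(1) \<open>f \<in> W'\<close>])
  then show ?thesis
    using holomorphic_maps_into_subset[of "ball 0 1" V] W'(2)
    by (intro that[of r L \<epsilon>]) (assumption+, blast)
qed

lemma openin_weak_star_seminorm_less:
  assumes "h \<in> holomorphic_maps U V" "K \<subseteq> U" "compact K" "finite L" "0 < r"
  shows "openin (compact_weak_star_open_into U V)
    {g \<in> holomorphic_maps U V. weak_star_seminorm K L (\<lambda>x. g x - h x) < r}"
proof -
  have h: "h \<in> holomorphic_maps U UNIV"
    using assms(1) holomorphic_maps_into_subset by blast
  have "openin (compact_weak_star_open U)
      {g \<in> holomorphic_maps U UNIV. weak_star_seminorm K L (\<lambda>x. g x - h x) < r}"
    unfolding compact_weak_star_open_def seminorm_topology_def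
    by (rule topology_generated_by_Basis) (use h assms in blast)
  then show ?thesis
    unfolding compact_weak_star_open_into_def openin_subtopology
    using holomorphic_maps_into_subset[of U V] by blast
qed

section \<open>Discontinuity of composition\<close>

lemma restrict_const_in_holomorphic_maps:
  assumes "open U" "v \<in> V"
  shows "restrict (\<lambda>_. v) U \<in> holomorphic_maps U V"
proof -
  have "(restrict (\<lambda>_. v) U has_derivative (\<lambda>_. 0)) (at x)" if "x \<in> U" for x
    by (rule has_derivative_transform_within_open[OF has_derivative_const[of v] \<open>open U\<close> that]) simp
  moreover have "c *\<^sub>C 0 = (0::'b)" for c
    by (metis norm_eq_zero norm_scaleC mult_zero_right)
  ultimately show ?thesis
    using assms(2) by (auto simp: holomorphic_maps_def frechet_holomorphic_on_def intro!: exI[of _ "\<lambda>_. 0"])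
qed

lemma bounded_linear_scaleC_left: "bounded_linear (\<lambda>c. c *\<^sub>C w)"
  by (rule bounded_linear_intro[where K = "norm w"])
    (simp_all add: scaleC_add_left scaleR_scaleC scaleC_scaleC norm_scaleC scaleR_conv_of_real)

lemma restrict_power_in_holomorphic_maps:
  fixes w :: "'a::complex_normed_vector"
  assumes "open U" "\<And>z. z \<in> U \<Longrightarrow> (cdual_apply z u) ^ n *\<^sub>C w \<in> V"
  shows "restrict (\<lambda>z. (cdual_apply z u) ^ n *\<^sub>C w) U \<in> holomorphic_maps U V"
proof -
  let ?f = "\<lambda>z. (cdual_apply z u) ^ n *\<^sub>C w"
  \<comment> \<open>For \<open>n = 0\<close> the truncated exponent \<open>n - 1\<close> is harmless
    because of the factor \<open>of_nat n\<close>.\<close>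
  let ?d = "\<lambda>z h. (of_nat n * cdual_apply h u * cdual_apply z u ^ (n - 1)) *\<^sub>C w"
  have "(?f has_derivative ?d z) (at z)" for z
    by (intro bounded_linear.has_derivative[OF bounded_linear_scaleC_left]
        has_derivative_power bounded_linear_imp_has_derivative bounded_linear_cdual_apply)
  then have "(restrict ?f U has_derivative ?d z) (at z)" if "z \<in> U" for z
    by (rule has_derivative_transform_within_open[OF _ \<open>open U\<close> that]) simp
  moreover have "?d z (c *\<^sub>C h) = c *\<^sub>C ?d z h" for z c h
    by (simp add: scaleC_scaleC mult_ac)
  ultimately have "frechet_holomorphic_on (restrict ?f U) U"
    unfolding frechet_holomorphic_on_def by blast
  then show ?thesis
    using assms(2) by (auto simp: holomorphic_maps_def)
qed

lemma power_functional_witness: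
  fixes \<phi> :: "'a::complex_normed_vector cdual"
  assumes "\<phi> \<noteq> 0" "0 < n"
  obtains t u where "norm u = 1" "norm (t *\<^sub>C \<phi>) < 1" "1 / 2 \<le> cmod (cdual_apply (t *\<^sub>C \<phi>) u) ^ n"
proof -
  \<comment> \<open>Two losses of a factor \<open>s\<close> occur: \<phi> is rescaled to norm
    \<open>s < 1\<close>, and \<open>u\<close> attains that norm only up to another
    \<open>s\<close>. Hence the \<open>2 * n\<close>-th root.\<close>
  define s where "s = root (2 * n) (1 / 2)"
  have s: "0 < s" "s < 1" "s ^ (2 * n) = 1 / 2"
    using assms(2) by (simp_all add: s_def real_root_lt_1_iff)
  obtain u where u: "norm u = 1" "s * norm \<phi> < cmod (cdual_apply \<phi> u)"
    using cdual_norm_approx[OF assms(1), of s] s by auto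
  let ?t = "complex_of_real (s / norm \<phi>)"
  show ?thesis
  proof (rule that[OF u(1)])
    show "norm (?t *\<^sub>C \<phi>) < 1"
      using assms(1) s by (simp add: norm_scaleC norm_divide)
    have "s * s \<le> cmod (cdual_apply (?t *\<^sub>C \<phi>) u)"
      using u(2) s assms(1) by (simp add: norm_mult norm_divide field_simps)
    then have "(s * s) ^ n \<le> cmod (cdual_apply (?t *\<^sub>C \<phi>) u) ^ n"
      using s by (intro power_mono) auto
    then show "1 / 2 \<le> cmod (cdual_apply (?t *\<^sub>C \<phi>) u) ^ n"
      using s(3) by (simp add: power_mult power2_eq_square)
  qed
qed

theorem theorem4p3:
  assumes "\<not> finite_dim_complex TYPE('f::complex_banach)"
  shows "let B = ball (0 :: 'f cdual) 1; T = compact_weak_star_open_into B B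
    in \<not> continuous_map (prod_topology T T) T (\<lambda>(f, g). compose B f g)"
proof -
  define B where "B = ball (0 :: 'f cdual) 1"
  define T where "T = compact_weak_star_open_into B B"
  have B: "open B" "0 \<in> B" by (auto simp: B_def)
  let ?H = "holomorphic_maps B B"
  define o0 where "o0 = restrict (\<lambda>_. 0 :: 'f cdual) B"
  have o0: "o0 \<in> ?H"
    unfolding o0_def using B by (rule restrict_const_in_holomorphic_maps)
  obtain \<omega> :: "'f cdual" where "\<omega> \<noteq> 0"
    by (rule annihilator_of_finite_nontrivial[OF assms finite.emptyI], rule that)
  \<comment> \<open>The case of exponent 1 supplies a direction \<open>w\<close> in the ball and a
    vector \<open>y0\<close> on which \<open>w\<close> is visibly nonzero.\<close>
  obtain t y0
    where "norm (t *\<^sub>C \<omega>) < 1" "1 / 2 \<le> cmod (cdual_apply (t *\<^sub>C \<omega>) y0) ^ 1"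
    by (rule power_functional_witness[OF \<open>\<omega> \<noteq> 0\<close> zero_less_one], rule that)
  then have "\<exists>w. norm w < 1 \<and> 1 / 2 \<le> cmod (cdual_apply w y0)"
    unfolding power_one_right by blast
  then obtain w where w: "norm w < 1" "1 / 2 \<le> cmod (cdual_apply w y0)"
    by blast
  \<comment> \<open>The composite built below is constant, so the single point 0 detects it. Its
    value at \<open>y0\<close> has modulus at least \<open>1 / 2 * (1 / 2)\<close>, just outside the
    strict bound.\<close>
  define W where "W = {h \<in> ?H. weak_star_seminorm {0} {y0} (\<lambda>x. h x - o0 x) < 1 / 4}"
  have W: "openin T W"
    unfolding T_def W_def using o0 B by (intro openin_weak_star_seminorm_less) auto
  have sem: "weak_star_seminorm {0} {y0} k = cmod (cdual_apply (k 0) y0)" for k :: "'f cdual \<Rightarrow> 'f cdual"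
    by (simp add: weak_star_seminorm_def sup_real_def max_def cSup_insert)
  have "\<not> continuous_map (prod_topology T T) T (\<lambda>(f, g). compose B f g)"
  proof
    let ?c = "\<lambda>(f, g). compose B f g"
    assume "continuous_map (prod_topology T T) T ?c"
    then have "openin (prod_topology T T) {p \<in> topspace (prod_topology T T). ?c p \<in> W}"
      using W by (rule openin_continuous_map_preimage)
    moreover have "(o0, o0) \<in> {p \<in> topspace (prod_topology T T). ?c p \<in> W}"
    proof -
      have "compose B o0 o0 \<in> ?H"
        using B(1) o0 o0 by (rule compose_in_holomorphic_maps)
      then show ?thesis
        using o0 B by (simp add: T_def topspace_compact_weak_star_open_into W_def sem)
          (simp add: o0_def compose_def)
    qed
    ultimately obtain U V where U: "openin T U" "o0 \<in> U" and V: "openin T V" "o0 \<in> V"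
      and UV: "U \<times> V \<subseteq> {p \<in> topspace (prod_topology T T). ?c p \<in> W}"
      unfolding openin_prod_topology_alt by blast
    obtain r L \<epsilon> where r: "0 \<le> r" "r < 1" and L: "finite L" and \<epsilon>: "0 < \<epsilon>"
      and U_near: "\<forall>f\<in>?H.
        (\<forall>x y. norm x \<le> r \<longrightarrow> y \<in> L \<longrightarrow> cmod (cdual_apply (f x - o0 x) y) \<le> \<epsilon>) \<longrightarrow> f \<in> U"
      unfolding B_def by (rule openin_compact_weak_star_open_into_nbhd[OF U[unfolded T_def B_def]])
    obtain r' L' \<epsilon>' where r': "0 \<le> r'" "r' < 1" and L': "finite L'" and \<epsilon>': "0 < \<epsilon>'"
      and V_near: "\<forall>f\<in>?H.
        (\<forall>x y. norm x \<le> r' \<longrightarrow> y \<in> L' \<longrightarrow> cmod (cdual_apply (f x - o0 x) y) \<le> \<epsilon>') \<longrightarrow> f \<in> V"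
      unfolding B_def by (rule openin_compact_weak_star_open_into_nbhd[OF V[unfolded T_def B_def]])
    \<comment> \<open>The summand 1 keeps \<open>M\<close> positive when \<open>L\<close> is
      empty.\<close>
    define M where "M = 1 + (\<Sum>y\<in>L. norm y)"
    have M: "0 < M" "\<And>y. y \<in> L \<Longrightarrow> norm y \<le> M"
      using L member_le_sum[of _ L norm] sum_nonneg[of L norm] by (force simp: M_def)+
    obtain n where n: "r ^ n < \<epsilon> / M"
      using real_arch_pow_inv[of "\<epsilon> / M" r] \<epsilon> M(1) r(2) by auto
    \<comment> \<open>The exponent \<open>Suc n\<close> is positive, as required by the witness
      lemma and for \<open>f\<close> to map into the open ball.\<close>
    have "r ^ Suc n \<le> r ^ n"
      using r by (intro power_decreasing) auto
    with n M(1) have rn: "r ^ Suc n * M \<le> \<epsilon>"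
      by (simp add: field_simps del: power_Suc) (meson M(1) mult_left_mono less_imp_le order_trans)
    obtain \<phi> :: "'f cdual" where \<phi>: "\<phi> \<noteq> 0" "\<forall>y\<in>L'. cdual_apply \<phi> y = 0"
      by (rule annihilator_of_finite_nontrivial[OF assms L'])
    \<comment> \<open>The order of choices matters: \<open>n\<close> comes from the neighbourhood of
      \<open>f\<close> alone, while \<open>u\<close> depends on \<open>n\<close> and on \<phi>. This
      is not circular because the smallness of \<open>f\<close> uses only
      \<open>norm u = 1\<close>.\<close>
    obtain t u where u: "norm u = 1" "norm (t *\<^sub>C \<phi>) < 1"
      "1 / 2 \<le> cmod (cdual_apply (t *\<^sub>C \<phi>) u) ^ Suc n"
      by (rule power_functional_witness[OF \<phi>(1) zero_less_Suc])
    let ?v = "t *\<^sub>C \<phi>"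
    define f where "f = restrict (\<lambda>z. cdual_apply z u ^ Suc n *\<^sub>C w) B"
    define g where "g = restrict (\<lambda>_. ?v) B"
    have v: "?v \<in> B" using u(2) by (simp add: B_def)
    have f_norm: "norm (cdual_apply z u ^ Suc n *\<^sub>C w) \<le> norm z ^ Suc n" for z
    proof -
      have "norm (cdual_apply z u ^ Suc n *\<^sub>C w) = cmod (cdual_apply z u) ^ Suc n * norm w"
        by (simp add: norm_scaleC norm_power norm_mult)
      also have "\<dots> \<le> norm z ^ Suc n * 1"
        using norm_cdual_apply[of z u] u(1) w(1) by (intro mult_mono power_mono) auto
      finally show ?thesis by simp
    qed
    have "f \<in> ?H"
      unfolding f_def
    proof (rule restrict_power_in_holomorphic_maps[OF B(1)])
      fix z assume "z \<in> B"
      then have "norm z ^ Suc n < 1"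
        using power_decreasing[of 1 "Suc n" "norm z"] by (simp add: B_def del: power_Suc)
      with f_norm[of z] show "cdual_apply z u ^ Suc n *\<^sub>C w \<in> B"
        by (simp add: B_def del: power_Suc)
    qed
    moreover have "cmod (cdual_apply (f x - o0 x) y) \<le> \<epsilon>" if x: "norm x \<le> r" and y: "y \<in> L" for x y
    proof -
      have "x \<in> B" using x r(2) by (simp add: B_def)
      then have "cmod (cdual_apply (f x - o0 x) y) \<le> norm (cdual_apply x u ^ Suc n *\<^sub>C w) * norm y"
        by (simp add: f_def o0_def norm_cdual_apply del: power_Suc cdual_apply_scaleC)
      also have "\<dots> \<le> r ^ Suc n * M"
        using f_norm[of x] power_mono[OF x, of "Suc n"] M(2)[OF y] r(1)
        by (intro mult_mono) (auto intro: order_trans simp del: power_Suc)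
      finally show ?thesis using rn by simp
    qed
    ultimately have "f \<in> U"
      using U_near by blast
    have "g \<in> ?H"
      unfolding g_def using B(1) v by (rule restrict_const_in_holomorphic_maps)
    \<comment> \<open>The difference is exactly 0 on \<open>L'\<close>, since \<open>?v\<close> is a
      multiple of \<phi>.\<close>
    moreover have "cmod (cdual_apply (g x - o0 x) y) \<le> \<epsilon>'" if x: "norm x \<le> r'" and y: "y \<in> L'" for x y
      using x y r'(2) \<phi>(2) \<epsilon>' by (simp add: g_def o0_def B_def)
    ultimately have "g \<in> V"
      using V_near by blast
    with \<open>f \<in> U\<close> have "(f, g) \<in> U \<times> V"
      by simp
    from subsetD[OF UV this] have "compose B f g \<in> W"
      by simp
    then have "cmod (cdual_apply ?v u ^ Suc n * cdual_apply w y0) < 1 / 4"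
      using v B(2) by (simp add: W_def sem f_def g_def o0_def compose_eq cdual_apply_diff_left del: power_Suc)
    moreover have "1 / 2 * (1 / 2) \<le> cmod (cdual_apply ?v u) ^ Suc n * cmod (cdual_apply w y0)"
      using u(3) w(2) by (intro mult_mono) auto
    ultimately show False
      by (simp add: norm_mult norm_power del: power_Suc cdual_apply_scaleC)
  qed
  then show ?thesis
    by (simp add: T_def B_def Let_def)
qed

end
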